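(* Let $y\in\mathbb{C}$ satisfy $e^{2iy}\neq -q^{m+1/2}$ for all $m\in\mathbb{Z}$. Suppose that $f$ is a meromorphic function on $\mathbb{C}$ which has only simple poles, that $\mathcal{P}=\{a_1,a_2,\ldots,a_n\}$ is a complete set of inequivalent poles of $f$, and that $f$ satisfies the functional equations $$f(z)=-f(z+\pi)=-e^{2iy}f(z+\pi\tau).$$ Then $$f(z)=\frac{\theta_1'(0|\tau)}{\theta_3(y|\tau)}\sum_{k=1}^{n}\mathrm{res}(f;a_k)\,\frac{\theta_3(z+y-a_k|\tau)}{\theta_1(z-a_k|\tau)}.$$
   Context: Fix $\tau\in\mathbb{C}$ with $\mathrm{Im}\,\tau>0$ and put $q=e^{2\pi i\tau}$, with $q^{s}=e^{2\pi i s\tau}$. The Jacobi theta functions used are the entire functions $\theta_1(z|\tau)=2\sum_{n=0}^\infty(-1)^n q^{(2n+1)^2/8}\sin((2n+1)z)$ and $\theta_3(z|\tau)=1+2\sum_{n=1}^\infty q^{n^2/2}\cos(2nz)$; a prime denotes the derivative with respect to the first variable $z$. Let $\Lambda=\{m\pi+n\pi\tau:(m,n)\in\mathbb{Z}^2\}$. Two complex numbers are equivalent if their difference lies in $\Lambda$ and inequivalent otherwise. A complete set of inequivalent poles of $f$ is a set of pairwise inequivalent poles such that every pole of $f$ is equivalent to one of them. $\mathrm{res}(f;a)$ is the residue of $f$ at $a$. The identity is one of meromorphic functions of $z$. *)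

theory Defs
  imports "HOL-Complex_Analysis.Complex_Analysis"
begin

text \<open>
  With \<open>q = exp (2 \<pi> \<i> \<tau>)\<close>, the power \<open>q\<^sup>s\<close> means \<open>exp (2 \<pi> \<i> s \<tau>)\<close>; it depends on \<open>\<tau>\<close> and not
  only on \<open>q\<close>, so it is not the principal branch \<open>q powr s\<close>.
\<close>
definition qpow :: "complex \<Rightarrow> real \<Rightarrow> complex" where
  "qpow \<tau> s = exp (2 * of_real pi * \<i> * of_real s * \<tau>)"

definition theta1 :: "complex \<Rightarrow> complex \<Rightarrow> complex" where
  "theta1 \<tau> z =
     2 * (\<Sum>n. (- 1) ^ n * qpow \<tau> (real ((2 * n + 1)\<^sup>2) / 8) * sin (of_nat (2 * n + 1) * z))"

text \<open>The series for \<open>\<theta>\<^sub>3\<close> starts at index 1, hence the shift to \<open>Suc n\<close>.\<close>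
definition theta3 :: "complex \<Rightarrow> complex \<Rightarrow> complex" where
  "theta3 \<tau> z =
     1 + 2 * (\<Sum>n. qpow \<tau> (real ((Suc n)\<^sup>2) / 2) * cos (2 * of_nat (Suc n) * z))"

definition period_lattice :: "complex \<Rightarrow> complex set" where
  "period_lattice \<tau> = {of_int m * of_real pi + of_int n * of_real pi * \<tau> | m n :: int. True}"

definition lattice_equiv :: "complex \<Rightarrow> complex \<Rightarrow> complex \<Rightarrow> bool" where
  "lattice_equiv \<tau> z w \<longleftrightarrow> z - w \<in> period_lattice \<tau>"

definition complete_inequivalent_poles ::
    "complex \<Rightarrow> (complex \<Rightarrow> complex) \<Rightarrow> complex set \<Rightarrow> bool" where
  "complete_inequivalent_poles \<tau> f P \<longleftrightarrow>
     (\<forall>a\<in>P. is_pole f a) \<and>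
     (\<forall>a\<in>P. \<forall>b\<in>P. a \<noteq> b \<longrightarrow> \<not> lattice_equiv \<tau> a b) \<and>
     (\<forall>z. is_pole f z \<longrightarrow> (\<exists>a\<in>P. lattice_equiv \<tau> z a))"

text \<open>
  In the library, \<open>f meromorphic_on UNIV\<close> leaves the values of \<open>f\<close> on a discrete closed set (in
  particular at the poles) arbitrary. Identities between meromorphic functions are therefore
  stated with \<open>\<forall>\<^sub>\<approx>z\<in>UNIV\<close>, that is, for all \<open>z\<close> outside a set without limit point in the plane.
\<close>

end

theory Submission
  imports Defs
begin

text \<open>
  The difference of the two sides has no poles, and under \<open>z \<mapsto> z + \<pi>\<close> and \<open>z \<mapsto> z + \<pi>\<tau>\<close> it is
  multiplied by the constants \<open>- 1\<close> and \<open>- exp (- 2 \<i> y)\<close>. By Liouville's theorem an entire function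
  with constant multipliers is \<open>C exp (c z)\<close>, and \<open>C \<noteq> 0\<close> is incompatible with these multipliers
  exactly because of the hypothesis on \<open>y\<close>. The simple zeros of \<open>\<theta>\<^sub>1\<close> at the lattice points
  come from the same principle: the quotient of \<open>\<theta>\<^sub>1\<close> by the infinite product of Jacobi's triple product
  identity is entire with constant multipliers, so it has no zeros.
\<close>

section \<open>Quasi-periodic functions with constant multipliers\<close>

text \<open>By Riemann's theorem on removable singularities, \<open>f\<close> agrees near
  \<open>a\<close> with a function holomorphic at \<open>a\<close>. The criterion serves both for
  \<open>theta1\<close> over its product and for the final difference.\<close>

lemma not_is_pole_if_mult_tendsto_0:
  assumes "isolated_singularity_at f a" and "((\<lambda>z. (z - a) * f z) \<longlongrightarrow> 0) (at a)"
  shows "\<not> is_pole f a"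
proof -
  obtain A where A: "open A" "a \<in> A" "f holomorphic_on (A - {a})"
    using assms(1) analytic_imp_holomorphic isolated_singularity_at_iff_analytic_nhd by auto
  then obtain g where g: "g holomorphic_on A" "\<forall>z\<in>A - {a}. g z = f z"
    using holomorphic_on_extend_lim[of f A a] assms(2) by (auto simp: interior_open)
  have "eventually (\<lambda>z. f z = g z) (at a)"
    using eventually_at_in_open[OF A(1,2)] by eventually_elim (use g in auto)
  then have "is_pole f a \<longleftrightarrow> is_pole g a"
    by (rule is_pole_cong) simp
  then show ?thesis
    using not_is_pole_holomorphic[OF A(1,2) g(1)] by simp
qed

text \<open>Order -1 means \<open>f w = zor_poly f a w / (w - a)\<close> near \<open>a\<close>. The
  numerator is continuous and its value at \<open>a\<close> is the residue.\<close>

lemma simple_pole_tendsto_residue: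
  assumes "isolated_singularity_at f a" and "is_pole f a" and "zorder f a = - 1"
  shows "((\<lambda>z. (z - a) * f z) \<longlongrightarrow> residue f a) (at a)"
proof -
  obtain A where A: "open A" "a \<in> A" "f holomorphic_on (A - {a})"
    using assms(1) analytic_imp_holomorphic isolated_singularity_at_iff_analytic_nhd by auto
  obtain r where r: "r > 0" "zor_poly f a holomorphic_on cball a r"
    "\<forall>w\<in>cball a r - {a}. f w = zor_poly f a w / (w - a) ^ nat (- zorder f a)"
    using zorder_exist_pole[OF A(3,1,2) assms(2)] by (auto)
  have "zor_poly f a holomorphic_on ball a r"
    using r(2) ball_subset_cball holomorphic_on_subset by blast
  then have "isCont (zor_poly f a) a"
    using r(1) by (auto dest!: holomorphic_on_imp_continuous_on
        simp: continuous_on_eq_continuous_at[OF open_ball])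
  then have "(zor_poly f a \<longlongrightarrow> residue f a) (at a)"
    using residue_simple_pole[OF assms] by (simp add: isCont_def)
  moreover have "eventually (\<lambda>w. w \<in> ball a r - {a}) (at a)"
    using r(1) by (intro eventually_at_in_open) auto
  then have "eventually (\<lambda>w. zor_poly f a w = (w - a) * f w) (at a)"
    by eventually_elim (use r(3) assms(3) in auto)
  ultimately show ?thesis
    using tendsto_cong by fastforce
qed

section \<open>Boundedness on the period parallelogram and Liouville's theorem\<close>

lemma period_parallelogram_decomposition:
  assumes "Im \<tau> > 0"
  obtains s t :: real and m n :: int where "s \<in> {0..1}" "t \<in> {0..1}"
    "z = of_real (s * pi) + of_real (t * pi) * \<tau> + (of_int m * of_real pi + of_int n * of_real pi * \<tau>)"
proof -
  \<comment> \<open>\<open>u\<close> and \<open>v\<close> are the real coordinates of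
    \<open>z\<close> in the basis pi, pi * \<tau>. Their floors give the lattice vector and their
    fractional parts the point of the parallelogram.\<close>
  define v where "v = Im z / (pi * Im \<tau>)"
  define u where "u = Re z / pi - v * Re \<tau>"
  have "z = of_real (u * pi) + of_real (v * pi) * \<tau>"
    using assms by (auto simp: complex_eq_iff u_def v_def field_simps)
  moreover have "of_real (u * pi) = (of_real (frac u * pi) + of_int \<lfloor>u\<rfloor> * of_real pi :: complex)"
    "of_real (v * pi) = (of_real (frac v * pi) + of_int \<lfloor>v\<rfloor> * of_real pi :: complex)"
    unfolding frac_def by (simp_all add: algebra_simps)
  ultimately have "z = of_real (frac u * pi) + of_real (frac v * pi) * \<tau>
      + (of_int \<lfloor>u\<rfloor> * of_real pi + of_int \<lfloor>v\<rfloor> * of_real pi * \<tau>)"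
    by (simp add: algebra_simps)
  moreover have "frac u \<in> {0..1}" "frac v \<in> {0..1}"
    by (simp_all add: frac_lt_1 less_imp_le)
  ultimately show ?thesis
    using that by blast
qed

text \<open>The codomain is arbitrary so that the lemma applies to the modulus of a function and
  also to predicates such as "is a pole" or "is a zero".\<close>

lemma int_translation_invariant:
  fixes g :: "'a :: ring_1 \<Rightarrow> 'b"
  assumes "\<And>z. g (z + w) = g z"
  shows "g (z + of_int m * w) = g z"
proof (induction m rule: int_induct[where k = 0])
  case (step1 i)
  then show ?case using assms[of "z + of_int i * w"] by (simp add: algebra_simps)
next
  case (step2 i)
  then show ?case using assms[of "z + of_int (i - 1) * w"] by (simp add: algebra_simps)
qed auto

text \<open>After multiplication by a suitable exponential the multipliers get modulus one, so that the
  product is bounded.\<close>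
lemma entire_quasi_periodic_imp_exp:
  assumes "Im \<tau> > 0" and g: "g holomorphic_on UNIV" and "\<alpha> \<noteq> 0" "\<beta> \<noteq> 0"
    and per1: "\<And>z. g (z + of_real pi) = \<alpha> * g z"
    and per2: "\<And>z. g (z + of_real pi * \<tau>) = \<beta> * g z"
  obtains C c where "\<And>z. g z = C * exp (c * z)"
proof -
  \<comment> \<open>\<open>cr\<close> and \<open>ci\<close> solve two real linear equations: the
    real parts of \<open>c * pi\<close> and \<open>c * pi * \<tau>\<close> must equal
    \<open>- ln (cmod \<alpha>)\<close> and \<open>- ln (cmod \<beta>)\<close>. The second is
    solvable for \<open>ci\<close> because \<open>Im \<tau>\<close> is nonzero.\<close>
  define cr where "cr = - ln (cmod \<alpha>) / pi"
  define ci where "ci = (ln (cmod \<beta>) / pi + cr * Re \<tau>) / Im \<tau>"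
  define c where "c = Complex cr ci"
  define H where "H z = exp (c * z) * g z" for z
  have "cmod (exp (c * of_real pi)) * cmod \<alpha> = exp (cr * pi + ln (cmod \<alpha>))"
    using assms(3) by (simp add: c_def exp_add)
  also have "\<dots> = 1" by (simp add: cr_def)
  finally have c1: "cmod (exp (c * of_real pi)) * cmod \<alpha> = 1" .
  have "cmod (exp (c * (of_real pi * \<tau>))) * cmod \<beta> = exp ((cr * Re \<tau> - ci * Im \<tau>) * pi + ln (cmod \<beta>))"
    using assms(4) by (simp add: c_def exp_add exp_diff algebra_simps)
  also have "(cr * Re \<tau> - ci * Im \<tau>) * pi + ln (cmod \<beta>) = 0"
    using assms(1) by (simp add: ci_def field_simps)
  finally have c2: "cmod (exp (c * (of_real pi * \<tau>))) * cmod \<beta> = 1" by simp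
  have "cmod (H (z + of_real pi)) = cmod (exp (c * of_real pi)) * cmod \<alpha> * cmod (H z)" for z
    by (simp add: H_def per1 ring_distribs exp_add norm_mult)
  then have n1: "cmod (H (z + of_real pi)) = cmod (H z)" for z
    unfolding c1 by simp
  have "cmod (H (z + of_real pi * \<tau>)) = cmod (exp (c * (of_real pi * \<tau>))) * cmod \<beta> * cmod (H z)" for z
    by (simp add: H_def per2 ring_distribs exp_add norm_mult)
  then have n2: "cmod (H (z + of_real pi * \<tau>)) = cmod (H z)" for z
    unfolding c2 by simp
  have inv: "cmod (H (z + (of_int m * of_real pi + of_int n * of_real pi * \<tau>))) = cmod (H z)" for z m n
    using int_translation_invariant[of "\<lambda>z. cmod (H z)", OF n1, of z m]
      int_translation_invariant[of "\<lambda>z. cmod (H z)", OF n2, of "z + of_int m * of_real pi" n]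
    by (simp add: algebra_simps)
  have H: "H holomorphic_on UNIV"
    unfolding H_def by (intro holomorphic_intros g)
  \<comment> \<open>\<open>K\<close> is the closed period parallelogram. Since
    \<open>cmod \<circ> H\<close> is invariant under the lattice, a bound on this compact set is a
    bound on the plane.\<close>
  define K where "K = (\<lambda>(s, t). of_real (s * pi) + of_real (t * pi) * \<tau>) ` ({0..1::real} \<times> {0..1::real})"
  have "compact K"
    unfolding K_def case_prod_unfold
    by (intro compact_continuous_image continuous_intros compact_Times) auto
  then have "compact (H ` K)"
    by (intro compact_continuous_image continuous_on_subset[OF holomorphic_on_imp_continuous_on[OF H]]) auto
  then obtain B where B: "\<And>w. w \<in> K \<Longrightarrow> cmod (H w) \<le> B"
    by (meson bounded_iff compact_imp_bounded image_eqI)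
  have "cmod (H z) \<le> B" for z
  proof -
    obtain s t m n where st: "s \<in> {0..1::real}" "t \<in> {0..1::real}" and z:
      "z = of_real (s * pi) + of_real (t * pi) * \<tau> + (of_int m * of_real pi + of_int n * of_real pi * \<tau>)"
      using period_parallelogram_decomposition[OF assms(1)] .
    have "of_real (s * pi) + of_real (t * pi) * \<tau> \<in> K"
      unfolding K_def using st by (intro image_eqI[of _ _ "(s, t)"]) auto
    then show ?thesis
      using B unfolding z inv by blast
  qed
  then have "bounded (range H)"
    by (auto simp: bounded_iff)
  then obtain C where "\<And>z. H z = C"
    using Liouville_theorem[OF H] by (auto simp: constant_on_def)
  then have "g z = C * exp (- c * z)" for z
    unfolding H_def by (metis exp_minus nonzero_divide_eq_eq divide_inverse exp_not_eq_zero minus_mult_left mult.commute)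
  then show ?thesis
    using that by blast
qed

text \<open>A meromorphic function without poles becomes entire once its removable singularities are
  filled in, which reduces this to the entire case. The second conclusion compares the multipliers
  of \<open>C * exp (c * z)\<close> with the given ones.\<close>

lemma meromorphic_quasi_periodic_imp_exp:
  assumes "Im \<tau> > 0" and h: "h meromorphic_on UNIV" "\<And>z. \<not> is_pole h z" and "\<alpha> \<noteq> 0" "\<beta> \<noteq> 0"
    and per1: "\<forall>\<^sub>\<approx>z\<in>UNIV. h (z + of_real pi) = \<alpha> * h z"
    and per2: "\<forall>\<^sub>\<approx>z\<in>UNIV. h (z + of_real pi * \<tau>) = \<beta> * h z"
  obtains C c where "\<forall>\<^sub>\<approx>z\<in>UNIV. h z = C * exp (c * z)"
    and "C = 0 \<or> exp (c * of_real pi) = \<alpha> \<and> exp (c * (of_real pi * \<tau>)) = \<beta>"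
proof -
  define g where "g = remove_sings h"
  have iso: "isolated_singularity_at h z" "not_essential h z" for z
    using meromorphic_on_subset[OF h(1), of "{z}"] by (auto simp: meromorphic_at_iff)
  have "g analytic_on {z}" for z
    unfolding g_def using iso[of z] h(2)[of z] remove_sings_analytic_at[of h z]
    unfolding not_essential_def by blast
  then have ana: "g analytic_on UNIV"
    using analytic_on_analytic_at by blast
  then have hol: "g holomorphic_on UNIV"
    by (rule analytic_imp_holomorphic)
  have ev: "eventually (\<lambda>w. g w = h w) (at z)" for z
    unfolding g_def by (rule eventually_remove_sings_eq_at) (rule iso)
  \<comment> \<open>The relation is known only off a discrete set. Both sides are continuous for
    \<open>g\<close>, so passing to the limit gives it at every point.\<close>
  have shift: "g (z + d) = \<gamma> * g z" if "\<forall>\<^sub>\<approx>z\<in>UNIV. h (z + d) = \<gamma> * h z" for d \<gamma> z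
  proof -
    have "eventually (\<lambda>w. g w = h w) (filtermap (\<lambda>w. w + d) (at z))"
      using ev[of "z + d"] filtermap_at_shift[of "- d" z] by simp
    then have "eventually (\<lambda>w. g (w + d) = h (w + d)) (at z)"
      by (simp add: eventually_filtermap)
    moreover have "eventually (\<lambda>w. h (w + d) = \<gamma> * h w) (at z)"
      using that by (simp add: eventually_cosparse_open_eq)
    ultimately have eq: "eventually (\<lambda>w. g (w + d) = \<gamma> * g w) (at z)"
      using ev[of z] by eventually_elim simp
    have isCont: "isCont g w" for w
      using holomorphic_on_imp_continuous_on[OF hol] by (simp add: continuous_on_eq_continuous_at)
    have "((\<lambda>w. \<gamma> * g w) \<longlongrightarrow> \<gamma> * g z) (at z)"
      using isCont[of z] by (intro tendsto_intros) (simp add: isCont_def)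
    moreover have "((\<lambda>w. \<gamma> * g w) \<longlongrightarrow> g (z + d)) (at z)"
      using isCont_o2[OF _ isCont, of z "\<lambda>w. w + d"] tendsto_cong[OF eq]
      by (simp add: isCont_def tendsto_add[OF tendsto_ident_at tendsto_const])
    ultimately show ?thesis
      using LIM_unique by blast
  qed
  obtain C c where C: "\<And>z. g z = C * exp (c * z)"
    using entire_quasi_periodic_imp_exp[OF assms(1) hol assms(4,5) shift[OF per1] shift[OF per2]] by blast
  have "\<forall>\<^sub>\<approx>z\<in>UNIV. h z = C * exp (c * z)"
    using ev by (simp add: eventually_cosparse_open_eq C eq_commute)
  \<comment> \<open>At \<open>z = 0\<close> the relations read
    \<open>C * exp (c * d) = \<gamma> * C\<close>, and a nonzero \<open>C\<close> cancels.\<close>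
  moreover have "C = 0 \<or> exp (c * of_real pi) = \<alpha> \<and> exp (c * (of_real pi * \<tau>)) = \<beta>"
    using shift[OF per1, of 0] shift[OF per2, of 0] by (auto simp: C)
  ultimately show ?thesis
    using that by blast
qed

section \<open>Theta functions as bilateral series\<close>

text \<open>The term q^(n^2/2) * e^(2 i n z) of the Laurent series of theta3 in e^(2 i z).\<close>

definition jterm :: "complex \<Rightarrow> complex \<Rightarrow> int \<Rightarrow> complex" where
  "jterm \<tau> z n = exp (\<i> * (of_real pi * \<tau> * of_int n ^ 2 + 2 * of_int n * z))"

text \<open>Links unordered sums over the integers with the one-sided series defining the theta
  functions. The negative half starts at -1, so index 0 is counted once.\<close>

lemma bilateral_sums:
  fixes t :: "int \<Rightarrow> 'a :: {banach, second_countable_topology}"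
  assumes "t summable_on UNIV"
  obtains A B where "(\<lambda>n. t (int n)) sums A" "(\<lambda>n. t (- int n - 1)) sums B" "infsum t UNIV = A + B"
proof -
  have U: "(UNIV :: int set) = range int \<union> range (\<lambda>n. - int n - 1)"
  proof safe
    fix n :: int
    assume "n \<notin> range (\<lambda>n. - int n - 1)"
    then have "n \<noteq> - int (nat (- n - 1)) - 1" by blast
    then have "n = int (nat n)" by linarith
    then show "n \<in> range int" by blast
  qed auto
  have disj: "range int \<inter> range (\<lambda>n. - int n - 1) = {}"
    by auto
  obtain A where A: "(t has_sum A) (range int)"
    using summable_on_subset_banach[OF assms, of "range int"] unfolding summable_on_def by auto
  obtain B where B: "(t has_sum B) (range (\<lambda>n. - int n - 1))"
    using summable_on_subset_banach[OF assms, of "range (\<lambda>n. - int n - 1)"]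
    unfolding summable_on_def by auto
  have "(t has_sum (A + B)) UNIV"
    unfolding U using A B disj by (rule has_sum_Un_disjoint)
  moreover have "((t \<circ> int) has_sum A) UNIV" "((t \<circ> (\<lambda>n. - int n - 1)) has_sum B) UNIV"
    using A B by (auto simp: has_sum_reindex inj_on_def)
  ultimately show ?thesis
    using that[of A B] by (auto dest!: has_sum_imp_sums simp: infsumI o_def)
qed

lemma summable_on_exp_neg_abs: "(\<lambda>n::int. exp (- \<bar>real_of_int n\<bar>)) summable_on UNIV"
proof -
  have U: "(UNIV :: int set) = range int \<union> range (\<lambda>n. - int n)"
  proof safe
    fix n :: int
    assume "n \<notin> range (\<lambda>n. - int n)"
    then have "n \<noteq> - int (nat (- n))" by blast
    then have "n = int (nat n)" by linarith
    then show "n \<in> range int" by blast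
  qed auto
  have "summable (\<lambda>n. exp (- 1 :: real) ^ n)"
    by (rule summable_geometric) simp
  then have "(\<lambda>n. exp (- real n)) summable_on UNIV"
    by (subst summable_on_UNIV_nonneg_real_iff) (auto simp flip: exp_of_nat_mult)
  then show ?thesis
    unfolding U
    by (intro summable_on_union) (auto simp: summable_on_reindex inj_on_def o_def)
qed

lemma norm_jterm: "cmod (jterm \<tau> z n) = exp (- (pi * Im \<tau> * of_int n ^ 2 + 2 * of_int n * Im z))"
  unfolding jterm_def by (simp flip: of_int_power)

text \<open>Completing the square lets the Gaussian decay absorb the linear growth and still leave a
  factor \<open>exp (- \<bar>n\<bar>)\<close>. The bound is uniform on a horizontal strip, as the
  Weierstrass test requires.\<close>

lemma norm_jterm_le:
  assumes "Im \<tau> > 0" and "\<bar>Im z\<bar> \<le> R"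
  shows "cmod (jterm \<tau> z n) \<le> exp ((2 * R + 1)\<^sup>2 / (4 * (pi * Im \<tau>))) * exp (- \<bar>real_of_int n\<bar>)"
proof -
  define c where "c = pi * Im \<tau>"
  define x where "x = \<bar>real_of_int n\<bar>"
  have c: "c > 0" using assms by (simp add: c_def)
  have "- (2 * of_int n * Im z) \<le> 2 * (x * \<bar>Im z\<bar>)"
    using abs_ge_minus_self[of "real_of_int n * Im z"] unfolding x_def by (simp add: abs_mult mult.commute)
  also have "\<dots> \<le> 2 * (x * R)"
    using assms(2) by (intro mult_left_mono) (auto simp: x_def)
  finally have "- (c * of_int n ^ 2 + 2 * of_int n * Im z) \<le> - c * x\<^sup>2 + 2 * x * R"
    by (simp add: x_def)
  also have "\<dots> = (2 * R + 1)\<^sup>2 / (4 * c) - x - (2 * c * x - (2 * R + 1))\<^sup>2 / (4 * c)"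
    using c by (simp add: field_simps power2_eq_square)
  also have "\<dots> \<le> (2 * R + 1)\<^sup>2 / (4 * c) - x"
    using c by simp
  finally show ?thesis
    unfolding norm_jterm c_def[symmetric] x_def[symmetric] by (simp flip: exp_add)
qed

text \<open>With a sum over all integers, the shift of the index by one is a plain reindexing; the
  behaviour under \<open>z + pi * \<tau>\<close> rests on it.\<close>

definition jtheta :: "complex \<Rightarrow> complex \<Rightarrow> complex" where
  "jtheta \<tau> z = infsum (jterm \<tau> z) UNIV"

lemma jterm_summable:
  assumes "Im \<tau> > 0"
  shows "jterm \<tau> z summable_on UNIV"
proof -
  have "(\<lambda>n::int. exp ((2 * \<bar>Im z\<bar> + 1)\<^sup>2 / (4 * (pi * Im \<tau>))) * exp (- \<bar>real_of_int n\<bar>)) summable_on UNIV"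
    by (intro summable_on_cmult_right summable_on_exp_neg_abs)
  then have "(\<lambda>n. norm (jterm \<tau> z n)) summable_on UNIV"
    by (rule Infinite_Sum.abs_summable_on_comparison_test') (rule norm_jterm_le[OF assms order_refl])
  then show ?thesis
    by (rule abs_summable_summable)
qed

lemma jtheta_uniform_limit:
  assumes "Im \<tau> > 0" and "\<And>z. z \<in> A \<Longrightarrow> \<bar>Im z\<bar> \<le> R"
  shows "uniform_limit A (\<lambda>N z. \<Sum>n\<in>N. jterm \<tau> z n) (jtheta \<tau>) (finite_subsets_at_top UNIV)"
  unfolding jtheta_def
proof (rule Weierstrass_m_test_general)
  show "cmod (jterm \<tau> z n) \<le> exp ((2 * R + 1)\<^sup>2 / (4 * (pi * Im \<tau>))) * exp (- \<bar>real_of_int n\<bar>)"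
    if "z \<in> A" for n z
    using norm_jterm_le assms that by blast
qed (intro summable_on_cmult_right summable_on_exp_neg_abs)

lemma jtheta_holomorphic:
  assumes "Im \<tau> > 0"
  shows "jtheta \<tau> holomorphic_on UNIV"
proof (rule analytic_imp_holomorphic, subst analytic_on_analytic_at, safe)
  fix z
  have "uniform_limit (cball z 1) (\<lambda>N z. \<Sum>n\<in>N. jterm \<tau> z n) (jtheta \<tau>) (finite_subsets_at_top UNIV)"
  proof (rule jtheta_uniform_limit[OF assms])
    fix w
    assume "w \<in> cball z 1"
    then have "cmod (w - z) \<le> 1"
      by (simp add: dist_norm norm_minus_commute)
    then show "\<bar>Im w\<bar> \<le> \<bar>Im z\<bar> + 1"
      using abs_Im_le_cmod[of "w - z"] by simp
  qed
  moreover have "eventually (\<lambda>N. continuous_on (cball z 1) (\<lambda>z. \<Sum>n\<in>N. jterm \<tau> z n) \<and>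
      (\<lambda>z. \<Sum>n\<in>N. jterm \<tau> z n) holomorphic_on ball z 1) (finite_subsets_at_top UNIV)"
    unfolding jterm_def by (intro always_eventually allI conjI continuous_intros holomorphic_intros)
  ultimately have "jtheta \<tau> holomorphic_on ball z 1"
    using holomorphic_uniform_limit[of z 1 _ "finite_subsets_at_top UNIV" "jtheta \<tau>"] by simp
  then show "jtheta \<tau> analytic_on {z}"
    by (meson analytic_at centre_in_ball open_ball zero_less_one)
qed

lemma jtheta_add_pi: "jtheta \<tau> (z + of_real pi) = jtheta \<tau> z"
proof -
  have "exp (\<i> * (2 * of_int n * of_real pi)) = 1" for n :: int
    using exp_integer_2pi[of "of_int n"] by (simp add: mult_ac)
  then have "jterm \<tau> (z + of_real pi) = jterm \<tau> z"
    unfolding jterm_def by (simp add: fun_eq_iff ring_distribs exp_add mult_ac)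
  then show ?thesis
    by (simp add: jtheta_def)
qed

text \<open>Adding \<open>pi * \<tau>\<close> to \<open>z\<close> contributes \<open>2 * n\<close>
  to the quadratic exponent, and n^2 + 2n = (n + 1)^2 - 1. So term n turns into term n + 1 up to a
  factor free of n.\<close>

lemma jtheta_add_pi_tau:
  "jtheta \<tau> (z + of_real pi * \<tau>) = exp (- \<i> * (of_real pi * \<tau> + 2 * z)) * jtheta \<tau> z"
proof -
  have "jterm \<tau> (z + of_real pi * \<tau>) n = exp (- \<i> * (of_real pi * \<tau> + 2 * z)) * jterm \<tau> z (n + 1)" for n
    unfolding jterm_def by (simp flip: exp_add, simp add: algebra_simps power2_eq_square)
  then have "jtheta \<tau> (z + of_real pi * \<tau>)
      = (\<Sum>\<^sub>\<infinity>n. exp (- \<i> * (of_real pi * \<tau> + 2 * z)) * jterm \<tau> z (n + 1))"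
    unfolding jtheta_def by (rule infsum_cong)
  also have "\<dots> = exp (- \<i> * (of_real pi * \<tau> + 2 * z)) * (\<Sum>\<^sub>\<infinity>n. jterm \<tau> z (n + 1))"
    by (rule infsum_cmult_right')
  also have "(\<Sum>\<^sub>\<infinity>n. jterm \<tau> z (n + 1)) = jtheta \<tau> z"
    unfolding jtheta_def
    by (rule infsum_reindex_bij_witness[of _ "\<lambda>n. n - 1" "\<lambda>n. n + 1"]) auto
  finally show ?thesis .
qed

section \<open>The Jacobi theta functions in terms of the bilateral series\<close>

lemma theta3_eq_jtheta:
  assumes "Im \<tau> > 0"
  shows "theta3 \<tau> z = jtheta \<tau> z"
proof -
  obtain A B where A: "(\<lambda>n. jterm \<tau> z (int n)) sums A" and B: "(\<lambda>n. jterm \<tau> z (- int n - 1)) sums B"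
    and "jtheta \<tau> z = A + B"
    using bilateral_sums[OF jterm_summable[OF assms, of z]] unfolding jtheta_def by metis
  \<comment> \<open>The term at index 0 is 1. What remains pairs the indices n + 1 and -(n + 1),
    whose exponentials add up to a cosine.\<close>
  have "(\<lambda>n. jterm \<tau> z (int (Suc n))) sums (A - 1)"
    using sums_Suc_iff[of "\<lambda>n. jterm \<tau> z (int n)" "A - 1"] A by (simp add: jterm_def)
  from sums_add[OF this B]
  have "(\<lambda>n. jterm \<tau> z (int (Suc n)) + jterm \<tau> z (- int n - 1)) sums (jtheta \<tau> z - 1)"
    unfolding \<open>jtheta \<tau> z = A + B\<close> by (simp add: algebra_simps)
  moreover have "jterm \<tau> z (int (Suc n)) + jterm \<tau> z (- int n - 1)
      = 2 * (qpow \<tau> (real ((Suc n)\<^sup>2) / 2) * cos (2 * of_nat (Suc n) * z))" for n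
    unfolding jterm_def qpow_def cos_exp_eq
    by (simp add: ring_distribs flip: exp_add) (simp add: algebra_simps power2_eq_square)
  ultimately have "(\<lambda>n. 2 * (qpow \<tau> (real ((Suc n)\<^sup>2) / 2) * cos (2 * of_nat (Suc n) * z)))
      sums (jtheta \<tau> z - 1)"
    by simp
  from sums_divide[OF this, of 2] have "2 * (\<Sum>n. qpow \<tau> (real ((Suc n)\<^sup>2) / 2) * cos (2 * of_nat (Suc n) * z)) = jtheta \<tau> z - 1"
    by (simp add: sums_iff mult.commute)
  then show ?thesis
    by (simp add: theta3_def)
qed

text \<open>A shift by the half period (pi + pi * \<tau>) / 2 turns the exponents n^2 into (2n +
  1)^2 / 4, up to the prefactor that completes the square, and brings in the signs (-1)^n. The terms
  n and -n - 1 then pair to a sine.\<close>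

lemma theta1_eq_jtheta:
  assumes "Im \<tau> > 0"
  shows "theta1 \<tau> z
    = - \<i> * exp (\<i> * (of_real pi * \<tau> / 4 + z)) * jtheta \<tau> (z + of_real pi / 2 + of_real pi * \<tau> / 2)"
proof -
  define w where "w = z + of_real pi / 2 + of_real pi * \<tau> / 2"
  define e where "e = - \<i> * exp (\<i> * (of_real pi * \<tau> / 4 + z))"
  obtain A B where A: "(\<lambda>n. jterm \<tau> w (int n)) sums A" and B: "(\<lambda>n. jterm \<tau> w (- int n - 1)) sums B"
    and AB: "jtheta \<tau> w = A + B"
    using bilateral_sums[OF jterm_summable[OF assms, of w]] unfolding jtheta_def by metis
  have sgn: "exp (\<i> * (of_nat n * of_real pi)) = (- 1) ^ n" for n
    using exp_of_nat_mult[of n "of_real pi * \<i>"] by (simp add: mult_ac)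
  have jt: "e * jterm \<tau> w n = - \<i> * (exp (\<i> * (of_int n * of_real pi)) *
      exp (\<i> * (of_real pi * \<tau> * of_int (2 * n + 1) ^ 2 / 4 + of_int (2 * n + 1) * z)))" for n
  proof -
    have "\<i> * (of_real pi * \<tau> / 4 + z) + \<i> * (of_real pi * \<tau> * of_int n ^ 2 + 2 * of_int n * w)
        = \<i> * (of_int n * of_real pi)
          + \<i> * (of_real pi * \<tau> * of_int (2 * n + 1) ^ 2 / 4 + of_int (2 * n + 1) * z)"
      by (simp add: w_def field_simps power2_eq_square)
    then show ?thesis
      unfolding e_def jterm_def by (simp add: mult.assoc flip: exp_add)
  qed
  have "e * jterm \<tau> w (int n)
      = - \<i> * (- 1) ^ n * (qpow \<tau> (real ((2 * n + 1)\<^sup>2) / 8) * exp (\<i> * (of_nat (2 * n + 1) * z)))" for n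
  proof -
    have "exp (\<i> * (of_real pi * \<tau> * of_int (2 * int n + 1) ^ 2 / 4 + of_int (2 * int n + 1) * z))
        = qpow \<tau> (real ((2 * n + 1)\<^sup>2) / 8) * exp (\<i> * (of_nat (2 * n + 1) * z))"
      unfolding qpow_def exp_add[symmetric] by (rule arg_cong[of _ _ exp]) (simp add: field_simps)
    then show ?thesis
      using sgn[of n] unfolding jt by simp
  qed
  moreover have "e * jterm \<tau> w (- int n - 1)
      = \<i> * (- 1) ^ n * (qpow \<tau> (real ((2 * n + 1)\<^sup>2) / 8) * exp (- (\<i> * (of_nat (2 * n + 1) * z))))" for n
  proof -
    have m: "2 * (- int n - 1) + 1 = - (2 * int n + 1)"
      by simp
    have "exp (\<i> * (of_real pi * \<tau> * of_int (2 * int n + 1) ^ 2 / 4 + of_int (- (2 * int n + 1)) * z))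
        = qpow \<tau> (real ((2 * n + 1)\<^sup>2) / 8) * exp (- (\<i> * (of_nat (2 * n + 1) * z)))"
      unfolding qpow_def exp_add[symmetric] by (rule arg_cong[of _ _ exp]) (simp add: field_simps)
    \<comment> \<open>The indices n and -n - 1 have opposite parity; this sign makes the pair a sine
      and not a cosine.\<close>
    moreover have "exp (\<i> * (of_int (- int n - 1) * of_real pi)) = - ((- 1) ^ n)"
    proof -
      have "\<i> * (of_int (- int n - 1) * of_real pi) = - (\<i> * (of_nat (Suc n) * of_real pi))"
        by (simp add: algebra_simps)
      then show ?thesis
        by (simp only: exp_minus sgn) (simp flip: power_inverse)
    qed
    ultimately show ?thesis
      unfolding jt m of_int_minus power2_minus by simp
  qed
  ultimately have "e * (jterm \<tau> w (int n) + jterm \<tau> w (- int n - 1))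
      = 2 * ((- 1) ^ n * qpow \<tau> (real ((2 * n + 1)\<^sup>2) / 8) * sin (of_nat (2 * n + 1) * z))" for n
    unfolding sin_exp_eq by (simp add: ring_distribs field_simps)
  moreover have "(\<lambda>n. e * (jterm \<tau> w (int n) + jterm \<tau> w (- int n - 1))) sums (e * jtheta \<tau> w)"
    unfolding AB by (intro sums_mult sums_add A B)
  ultimately have "(\<lambda>n. 2 * ((- 1) ^ n * qpow \<tau> (real ((2 * n + 1)\<^sup>2) / 8) * sin (of_nat (2 * n + 1) * z)))
      sums (e * jtheta \<tau> w)"
    by simp
  from sums_divide[OF this, of 2] have "theta1 \<tau> z = e * jtheta \<tau> w"
    unfolding theta1_def by (simp add: sums_iff mult.commute)
  then show ?thesis
    by (simp add: e_def w_def)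
qed

text \<open>The mean over the period [0, pi] picks out the constant Fourier coefficient, which is 1,
  so the integral is pi.\<close>

lemma jtheta_not_identically_zero:
  assumes "Im \<tau> > 0"
  obtains z where "jtheta \<tau> z \<noteq> 0"
proof -
  define f where "f N t = (\<Sum>n\<in>N. jterm \<tau> (of_real t) n)" for N and t :: real
  have "uniform_limit (range of_real) (\<lambda>N z. \<Sum>n\<in>N. jterm \<tau> z n) (jtheta \<tau>) (finite_subsets_at_top UNIV)"
    by (rule jtheta_uniform_limit[OF assms, of _ 0]) auto
  then have "uniform_limit {0..pi} f (\<lambda>t. jtheta \<tau> (of_real t)) (finite_subsets_at_top UNIV)"
    unfolding f_def uniform_limit_iff by (auto elim!: eventually_mono)
  moreover have "continuous_on {0..pi} (f N)" for N
    unfolding f_def jterm_def by (intro continuous_intros)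
  ultimately obtain I J where I: "\<And>N. (f N has_integral I N) {0..pi}"
    and J: "((\<lambda>t. jtheta \<tau> (of_real t)) has_integral J) {0..pi}"
    and lim: "(I \<longlongrightarrow> J) (finite_subsets_at_top UNIV)"
    by (rule uniform_limit_integral) auto
  have int: "((\<lambda>t. jterm \<tau> (of_real t) n) has_integral (if n = 0 then of_real pi else 0)) {0..pi}" for n
  proof (cases "n = 0")
    case True
    then show ?thesis
      using has_integral_const_real[of "1 :: complex" 0 pi] by (simp add: jterm_def scaleR_conv_of_real)
  next
    case False
    define F where "F t = jterm \<tau> (of_real t) n / (2 * \<i> * of_int n)" for t :: real
    have "((\<lambda>z. jterm \<tau> z n / (2 * \<i> * of_int n)) has_field_derivative jterm \<tau> z n) (at z)" for z
      unfolding jterm_def using False by (auto intro!: derivative_eq_intros)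
    then have "(F has_vector_derivative jterm \<tau> (of_real t) n) (at t within {0..pi})" for t
      unfolding F_def by (rule has_vector_derivative_real_field)
    then have "((\<lambda>t. jterm \<tau> (of_real t) n) has_integral (F pi - F 0)) {0..pi}"
      by (intro fundamental_theorem_of_calculus) auto
    moreover have "jterm \<tau> (of_real pi) n = jterm \<tau> 0 n"
      using exp_integer_2pi[of "of_int n"] by (simp add: jterm_def ring_distribs exp_add mult_ac)
    ultimately show ?thesis
      using False by (simp add: F_def)
  qed
  have "I N = (\<Sum>n\<in>N. if n = 0 then of_real pi else 0)" if "finite N" for N
    proof (rule has_integral_unique[OF I])
    show "(f N has_integral (\<Sum>n\<in>N. if n = 0 then of_real pi else 0)) {0..pi}"
      unfolding f_def by (intro has_integral_sum that int)
  qed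
  \<comment> \<open>Every finite index set that contains 0 has integral exactly pi.\<close>
  then have "eventually (\<lambda>N. I N = of_real pi) (finite_subsets_at_top UNIV)"
    unfolding eventually_finite_subsets_at_top by (intro exI[of _ "{0}"]) auto
  then have "J = of_real pi"
    using tendsto_unique[OF _ lim tendsto_eventually] by simp
  then have "jtheta \<tau> \<noteq> (\<lambda>_. 0)"
    using has_integral_unique[OF J, of 0] by fastforce
  then show ?thesis
    using that by blast
qed

section \<open>The product for the first theta function\<close>

text \<open>The infinite q-Pochhammer symbol (x; q).\<close>

definition qprod :: "complex \<Rightarrow> complex \<Rightarrow> complex" where
  "qprod q x = (\<Prod>n. 1 - q ^ n * x)"

lemma qprod_convergent:
  assumes "cmod q < 1"
  shows "convergent_prod (\<lambda>n. 1 - q ^ n * x)"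
proof (rule abs_convergent_prod_imp_convergent_prod)
  have "summable (\<lambda>n. cmod q ^ n * cmod x)"
    using assms by (intro summable_mult2 summable_geometric) auto
  then show "abs_convergent_prod (\<lambda>n. 1 - q ^ n * x)"
    unfolding abs_convergent_prod_conv_summable by (simp add: norm_mult norm_power)
qed

lemma qprod_holomorphic:
  assumes "cmod q < 1"
  shows "qprod q holomorphic_on UNIV"
proof (rule holomorphic_uniform_sequence)
  show "(\<lambda>x. \<Prod>n<N. 1 - q ^ n * x) holomorphic_on UNIV" for N
    by (intro holomorphic_intros)
  fix z
  have "uniformly_convergent_on (cball z 1) (\<lambda>N x. \<Prod>n<N. 1 - q ^ n * x)"
  proof (rule uniformly_convergent_on_prod')
    have "uniformly_convergent_on (cball z 1) (\<lambda>N x. \<Sum>n<N. cmod (q ^ n * x))"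
    proof (rule Weierstrass_m_test')
      fix n x
      assume "x \<in> cball z 1"
      then have "cmod x \<le> cmod z + 1"
        using norm_triangle_ineq2[of x z] by (simp add: dist_norm norm_minus_commute)
      then show "norm (cmod (q ^ n * x)) \<le> cmod q ^ n * (cmod z + 1)"
        by (simp add: norm_mult norm_power mult_left_mono)
    qed (use assms in \<open>intro summable_mult2 summable_geometric, auto\<close>)
    then show "uniformly_convergent_on (cball z 1) (\<lambda>N x. \<Sum>n<N. cmod (1 - q ^ n * x - 1))"
      by simp
  qed (auto intro!: continuous_intros)
  moreover have "lim (\<lambda>N. \<Prod>n<N. 1 - q ^ n * x) = qprod q x" for x
    using convergent_prod_LIMSEQ[OF qprod_convergent[OF assms, of x]]
    unfolding qprod_def LIMSEQ_lessThan_iff_atMost[symmetric] by (rule limI)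
  ultimately have "uniform_limit (cball z 1) (\<lambda>N x. \<Prod>n<N. 1 - q ^ n * x) (qprod q) sequentially"
    by (simp add: uniformly_convergent_uniform_limit_iff)
  then show "\<exists>d>0. cball z d \<subseteq> UNIV \<and>
      uniform_limit (cball z d) (\<lambda>N x. \<Prod>n<N. 1 - q ^ n * x) (qprod q) sequentially"
    by (intro exI[of _ 1]) auto
qed auto

lemma qprod_rec:
  assumes "cmod q < 1"
  shows "qprod q x = (1 - x) * qprod q (q * x)"
  using has_prod_unique[OF has_prod_ignore_initial_segment'[OF qprod_convergent[OF assms, of x], of 1]]
  by (simp add: qprod_def mult_ac)

text \<open>A convergent infinite product vanishes only if one of its factors does.\<close>

lemma qprod_eq_0_imp:
  assumes "cmod q < 1" and "qprod q x = 0"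
  obtains n where "q ^ n * x = 1"
  using prodinf_nonzero[OF qprod_convergent[OF assms(1), of x]] assms(2) unfolding qprod_def by force

section \<open>The product side of Jacobi's triple product as a function of z\<close>

definition nome :: "complex \<Rightarrow> complex" where
  "nome \<tau> = exp (2 * \<i> * (of_real pi * \<tau>))"

text \<open>With x = e^(2 i z) and q = \<open>nome \<tau>\<close> this is (x; q) * (q/x; q), the
  part of the triple product that carries the zeros.\<close>

definition theta_prod :: "complex \<Rightarrow> complex \<Rightarrow> complex" where
  "theta_prod \<tau> z = qprod (nome \<tau>) (exp (2 * \<i> * z)) * qprod (nome \<tau>) (nome \<tau> * exp (- (2 * \<i> * z)))"

lemma norm_nome: "Im \<tau> > 0 \<Longrightarrow> cmod (nome \<tau>) < 1"
  by (simp add: nome_def)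

lemma theta_prod_holomorphic:
  assumes "Im \<tau> > 0"
  shows "theta_prod \<tau> holomorphic_on UNIV"
  unfolding theta_prod_def
  by (intro holomorphic_intros
      holomorphic_on_compose_gen[OF _ qprod_holomorphic[OF norm_nome[OF assms]], unfolded o_def]) auto

lemma theta_prod_add_pi: "theta_prod \<tau> (z + of_real pi) = theta_prod \<tau> z"
proof -
  have "exp (2 * \<i> * (z + of_real pi)) = exp (2 * \<i> * z)"
    using exp_integer_2pi[of 1] by (simp add: ring_distribs exp_add mult_ac)
  then show ?thesis
    unfolding theta_prod_def by (simp only: exp_minus)
qed

text \<open>The shift replaces x by q * x: the first product loses its factor 1 - x and the second
  gains 1 - 1/x. The quotient of these two factors is -1/x.\<close>

lemma theta_prod_add_pi_tau:
  assumes "Im \<tau> > 0"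
  shows "theta_prod \<tau> (z + of_real pi * \<tau>) = - exp (- (2 * \<i> * z)) * theta_prod \<tau> z"
proof -
  define x where "x = exp (2 * \<i> * z)"
  have [simp]: "x \<noteq> 0" "nome \<tau> \<noteq> 0" by (simp_all add: x_def nome_def)
  have "exp (2 * \<i> * (z + of_real pi * \<tau>)) = nome \<tau> * x"
    unfolding x_def nome_def by (simp add: ring_distribs exp_add)
  then have "theta_prod \<tau> (z + of_real pi * \<tau>) = qprod (nome \<tau>) (nome \<tau> * x) * qprod (nome \<tau>) (1 / x)"
    unfolding theta_prod_def exp_minus by (simp add: divide_simps)
  also have "qprod (nome \<tau>) (1 / x) = (1 - 1 / x) * qprod (nome \<tau>) (nome \<tau> * (1 / x))"
    by (rule qprod_rec[OF norm_nome[OF assms]])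
  also have "1 - 1 / x = - (1 / x) * (1 - x)"
    by (simp add: field_simps)
  finally have "theta_prod \<tau> (z + of_real pi * \<tau>) =
      - (1 / x) * (((1 - x) * qprod (nome \<tau>) (nome \<tau> * x)) * qprod (nome \<tau>) (nome \<tau> * (1 / x)))"
    by simp
  also have "(1 - x) * qprod (nome \<tau>) (nome \<tau> * x) = qprod (nome \<tau>) x"
    by (rule qprod_rec[OF norm_nome[OF assms], symmetric])
  finally show ?thesis
    unfolding theta_prod_def exp_minus x_def[symmetric] by (simp add: divide_inverse)
qed

lemma exp_2i_eq_1_imp:
  assumes "exp (2 * \<i> * z) = 1"
  obtains m :: int where "z = of_int m * of_real pi"
proof -
  obtain m :: int where "2 * \<i> * z = of_real (of_int (2 * m) * pi) * \<i>"
    using assms exp_eq[of "2 * \<i> * z" 0] by auto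
  then show ?thesis
    using that[of m] by simp
qed

lemma theta_prod_eq_0_imp:
  assumes "Im \<tau> > 0" and "theta_prod \<tau> z = 0"
  shows "z \<in> period_lattice \<tau>"
proof -
  have nome_power: "nome \<tau> ^ n = exp (2 * \<i> * (of_nat n * of_real pi * \<tau>))" for n
    unfolding nome_def by (simp add: mult_ac flip: exp_of_nat_mult)
  from assms(2) consider "qprod (nome \<tau>) (exp (2 * \<i> * z)) = 0"
    | "qprod (nome \<tau>) (nome \<tau> * exp (- (2 * \<i> * z))) = 0"
    by (auto simp: theta_prod_def)
  then show ?thesis
  proof cases
    case 1
    then obtain n where "nome \<tau> ^ n * exp (2 * \<i> * z) = 1"
      using qprod_eq_0_imp norm_nome[OF assms(1)] by blast
    then have "exp (2 * \<i> * (of_nat n * of_real pi * \<tau> + z)) = 1"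
      by (simp add: nome_power exp_add ring_distribs)
    then obtain m where "of_nat n * of_real pi * \<tau> + z = of_int m * of_real pi"
      by (rule exp_2i_eq_1_imp)
    then have "z = of_int m * of_real pi + of_int (- int n) * of_real pi * \<tau>"
      by (simp add: algebra_simps)
    then show ?thesis
      unfolding period_lattice_def by blast
  next
    case 2
    then obtain n where "nome \<tau> ^ n * (nome \<tau> * exp (- (2 * \<i> * z))) = 1"
      using qprod_eq_0_imp norm_nome[OF assms(1)] by blast
    then have "nome \<tau> ^ Suc n * exp (- (2 * \<i> * z)) = 1"
      by (simp add: mult_ac)
    then have "exp (2 * \<i> * (of_nat (Suc n) * of_real pi * \<tau> - z)) = 1"
      by (simp only: nome_power exp_diff right_diff_distrib exp_minus divide_inverse)
    then obtain m where "of_nat (Suc n) * of_real pi * \<tau> - z = of_int m * of_real pi"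
      by (rule exp_2i_eq_1_imp)
    then have "z = of_int (- m) * of_real pi + of_int (int (Suc n)) * of_real pi * \<tau>"
      by (simp add: algebra_simps)
    then show ?thesis
      unfolding period_lattice_def by blast
  qed
qed

text \<open>Splitting off the factor 1 - e^(2 i z) leaves \<open>R\<close>, so the derivative at 0
  is -2 i * R(0). Here R(0) is the square of (q; q), which is nonzero because no power q^(n+1)
  equals 1.\<close>

lemma theta_prod_has_nonzero_derivative_0:
  assumes "Im \<tau> > 0"
  obtains D where "D \<noteq> 0" "(theta_prod \<tau> has_field_derivative D) (at 0)" "theta_prod \<tau> 0 = 0"
proof -
  define R where
    "R z = qprod (nome \<tau>) (nome \<tau> * exp (2 * \<i> * z)) * qprod (nome \<tau>) (nome \<tau> * exp (- (2 * \<i> * z)))" for z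
  have eq: "theta_prod \<tau> z = (1 - exp (2 * \<i> * z)) * R z" for z
    using qprod_rec[OF norm_nome[OF assms], of "exp (2 * \<i> * z)"] by (simp add: theta_prod_def R_def)
  have "R holomorphic_on UNIV"
    unfolding R_def
    by (intro holomorphic_intros
        holomorphic_on_compose_gen[OF _ qprod_holomorphic[OF norm_nome[OF assms]], unfolded o_def]) auto
  then obtain R' where R': "(R has_field_derivative R') (at 0)"
    using holomorphic_on_imp_differentiable_at[of R UNIV 0] by (auto simp: field_differentiable_def)
  have "(theta_prod \<tau> has_field_derivative - (2 * \<i>) * R 0) (at 0)"
    unfolding eq[abs_def] by (auto intro!: derivative_eq_intros R')
  moreover have "qprod (nome \<tau>) (nome \<tau>) \<noteq> 0"
  proof
    assume "qprod (nome \<tau>) (nome \<tau>) = 0"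
    then obtain n where "nome \<tau> ^ n * nome \<tau> = 1"
      using qprod_eq_0_imp norm_nome[OF assms] by blast
    then have "cmod (nome \<tau>) ^ Suc n = 1"
      by (metis norm_one norm_power power_Suc2)
    then show False
      using norm_nome[OF assms] power_less_one_iff[of "cmod (nome \<tau>)" "Suc n"] by simp
  qed
  then have "R 0 \<noteq> 0"
    by (simp add: R_def)
  ultimately show ?thesis
    using that eq[of 0] by (metis exp_zero diff_self mult_eq_0_iff mult_zero_right neg_equal_0_iff_equal complex_i_not_zero zero_neq_numeral)
qed

text \<open>Being a pole depends only on a punctured neighbourhood and survives a nonzero factor, so
  relations off a discrete set suffice.\<close>

lemma is_pole_add_period_lattice_iff:
  fixes h :: "complex \<Rightarrow> complex"
  assumes "\<alpha> \<noteq> 0" "\<beta> \<noteq> 0"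
    and per1: "\<forall>\<^sub>\<approx>z\<in>UNIV. h (z + of_real pi) = \<alpha> * h z"
    and per2: "\<forall>\<^sub>\<approx>z\<in>UNIV. h (z + of_real pi * \<tau>) = \<beta> * h z"
    and "w \<in> period_lattice \<tau>"
  shows "is_pole h (z + w) \<longleftrightarrow> is_pole h (z :: complex)"
proof -
  have shift: "is_pole h (z + d) \<longleftrightarrow> is_pole h z"
    if "\<gamma> \<noteq> (0 :: complex)" and ev: "\<forall>\<^sub>\<approx>z\<in>UNIV. h (z + d) = \<gamma> * h z" for d \<gamma> z
  proof -
    have "is_pole h (z + d) \<longleftrightarrow> is_pole (\<lambda>w. h (w + d)) z"
      using is_pole_shift_iff[of h d z] by (simp add: o_def add.commute)
    also have "\<dots> \<longleftrightarrow> is_pole (\<lambda>w. \<gamma> * h w) z"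
      using ev by (intro is_pole_cong) (auto simp: eventually_cosparse_open_eq)
    finally show ?thesis
      using that(1) by simp
  qed
  obtain m n :: int where "w = of_int m * of_real pi + of_int n * (of_real pi * \<tau>)"
    using assms(5) by (auto simp: period_lattice_def mult.assoc)
  then show ?thesis
    using int_translation_invariant[of "is_pole h", OF shift[OF assms(1) per1], of z m]
      int_translation_invariant[of "is_pole h", OF shift[OF assms(2) per2], of "z + of_int m * of_real pi" n]
    by (simp add: add.assoc)
qed

section \<open>Zeros of the theta functions\<close>

lemma theta3_holomorphic: "Im \<tau> > 0 \<Longrightarrow> theta3 \<tau> holomorphic_on A"
  using jtheta_holomorphic theta3_eq_jtheta holomorphic_on_subset[of "jtheta \<tau>" UNIV A]
  by (simp cong: holomorphic_cong)

lemma theta1_holomorphic: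
  assumes "Im \<tau> > 0"
  shows "theta1 \<tau> holomorphic_on A"
  unfolding theta1_eq_jtheta[OF assms, abs_def]
  by (intro holomorphic_intros holomorphic_on_compose_gen[OF _ jtheta_holomorphic[OF assms], unfolded o_def]) auto

lemma theta3_add_pi: "Im \<tau> > 0 \<Longrightarrow> theta3 \<tau> (z + of_real pi) = theta3 \<tau> z"
  by (simp add: theta3_eq_jtheta jtheta_add_pi)

lemma theta3_add_pi_tau:
  "Im \<tau> > 0 \<Longrightarrow> theta3 \<tau> (z + of_real pi * \<tau>) = exp (- \<i> * (of_real pi * \<tau> + 2 * z)) * theta3 \<tau> z"
  by (simp only: theta3_eq_jtheta jtheta_add_pi_tau)

lemma theta1_add_pi:
  assumes "Im \<tau> > 0"
  shows "theta1 \<tau> (z + of_real pi) = - theta1 \<tau> z"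
proof -
  have "exp (\<i> * (of_real pi * \<tau> / 4 + (z + of_real pi))) = - exp (\<i> * (of_real pi * \<tau> / 4 + z))"
    by (simp add: ring_distribs exp_add mult.commute[of _ "of_real pi"])
  then show ?thesis
    using jtheta_add_pi[of \<tau> "z + of_real pi / 2 + of_real pi * \<tau> / 2"]
    unfolding theta1_eq_jtheta[OF assms] by (simp add: algebra_simps)
qed

lemma theta1_add_pi_tau:
  assumes "Im \<tau> > 0"
  shows "theta1 \<tau> (z + of_real pi * \<tau>) = - exp (- \<i> * (of_real pi * \<tau> + 2 * z)) * theta1 \<tau> z"
proof -
  define w where "w = z + of_real pi / 2 + of_real pi * \<tau> / 2"
  have "theta1 \<tau> (z + of_real pi * \<tau>)
      = - \<i> * exp (\<i> * (of_real pi * \<tau> / 4 + (z + of_real pi * \<tau>))) * jtheta \<tau> (w + of_real pi * \<tau>)"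
    unfolding theta1_eq_jtheta[OF assms] w_def by (simp add: algebra_simps)
  also have "\<dots> = - \<i> * (exp (\<i> * (of_real pi * \<tau> / 4 + (z + of_real pi * \<tau>)))
      * exp (- \<i> * (of_real pi * \<tau> + 2 * w))) * jtheta \<tau> w"
    by (simp only: jtheta_add_pi_tau mult.assoc)
  \<comment> \<open>The pi / 2 inside \<open>w\<close> is doubled here and yields exp(-i pi), the
    minus sign that \<open>theta3\<close> does not have.\<close>
  also have "exp (\<i> * (of_real pi * \<tau> / 4 + (z + of_real pi * \<tau>))) * exp (- \<i> * (of_real pi * \<tau> + 2 * w))
      = exp (- \<i> * (of_real pi * \<tau> + 2 * z)) * exp (\<i> * (of_real pi * \<tau> / 4 + z)) * exp (- (of_real pi * \<i>))"
    unfolding exp_add[symmetric] by (rule arg_cong[of _ _ exp]) (simp add: w_def field_simps)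
  finally show ?thesis
    unfolding theta1_eq_jtheta[OF assms] w_def[symmetric] by (simp add: exp_minus)
qed

lemma theta1_0: "theta1 \<tau> 0 = 0"
  by (simp add: theta1_def)

lemma theta1_period_lattice_eq_0:
  assumes "Im \<tau> > 0" and "z \<in> period_lattice \<tau>"
  shows "theta1 \<tau> z = 0"
proof -
  obtain m n :: int where z: "z = 0 + of_int m * of_real pi + of_int n * (of_real pi * \<tau>)"
    using assms(2) by (auto simp: period_lattice_def mult.assoc)
  show ?thesis
    unfolding z
    using int_translation_invariant[of "\<lambda>z. theta1 \<tau> z = 0" "of_real pi" 0 m]
      int_translation_invariant[of "\<lambda>z. theta1 \<tau> z = 0" "of_real pi * \<tau>" "0 + of_int m * of_real pi" n]
    by (simp add: theta1_add_pi theta1_add_pi_tau assms(1) theta1_0)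
qed

text \<open>A weak form of the triple product identity, with \<open>C\<close> and \<open>c\<close>
  left unspecified: \<open>h\<close> has constant multipliers, and the zeros of
  \<open>theta1\<close> cancel those of the product. It transfers the simple zeros of the product to
  \<open>theta1\<close>.\<close>

lemma theta1_eq_theta_prod:
  assumes "Im \<tau> > 0"
  obtains C c where "C \<noteq> 0" "\<And>z. theta1 \<tau> z = C * exp (c * z) * theta_prod \<tau> z"
proof -
  define h where "h z = theta1 \<tau> z / theta_prod \<tau> z" for z
  have ana: "theta1 \<tau> analytic_on A" "theta_prod \<tau> analytic_on A" for A
    using analytic_on_subset[of _ UNIV A] theta1_holomorphic[OF assms, of UNIV] theta_prod_holomorphic[OF assms]
    by (auto simp: analytic_on_open)
  have mer: "h meromorphic_on A" for A
    unfolding h_def by (intro meromorphic_intros analytic_on_imp_meromorphic_on ana)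
  have per1: "h (z + of_real pi) = - 1 * h z" for z
    by (simp add: h_def theta1_add_pi theta_prod_add_pi assms)
  have per2: "h (z + of_real pi * \<tau>) = exp (- \<i> * (of_real pi * \<tau>)) * h z" for z
    by (simp add: h_def theta1_add_pi_tau theta_prod_add_pi_tau assms ring_distribs exp_diff exp_add exp_minus)
      (simp add: field_simps)
  have pers: "\<forall>\<^sub>\<approx>z\<in>UNIV. h (z + of_real pi) = - 1 * h z"
    "\<forall>\<^sub>\<approx>z\<in>UNIV. h (z + of_real pi * \<tau>) = exp (- \<i> * (of_real pi * \<tau>)) * h z"
    by (intro always_eventually allI per1 per2)+
  have "\<not> is_pole h 0"
  proof (rule not_is_pole_if_mult_tendsto_0)
    show "isolated_singularity_at h 0"
      using mer[of "{0}"] by (simp add: meromorphic_at_iff)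
    obtain D where D: "D \<noteq> 0" "(theta_prod \<tau> has_field_derivative D) (at 0)" "theta_prod \<tau> 0 = 0"
      using theta_prod_has_nonzero_derivative_0[OF assms] .
    have "((\<lambda>z. theta_prod \<tau> z / z) \<longlongrightarrow> D) (at 0)"
      using D(2,3) by (simp add: has_field_derivative_iff)
    moreover have "(theta1 \<tau> \<longlongrightarrow> theta1 \<tau> 0) (at 0)"
      using analytic_at_imp_isCont[OF ana(1)] by (simp add: isCont_def)
    \<comment> \<open>The denominator has a simple zero at 0 and the numerator vanishes there as
      well, so z * h(z) tends to 0.\<close>
    ultimately have "((\<lambda>z. theta1 \<tau> z / (theta_prod \<tau> z / z)) \<longlongrightarrow> 0 / D) (at 0)"
      using D(1) by (intro tendsto_divide) (simp_all add: theta1_0)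
    then show "((\<lambda>z. (z - 0) * h z) \<longlongrightarrow> 0) (at 0)"
      by (simp add: h_def mult.commute)
  qed
  then have "\<not> is_pole h z" if "z \<in> period_lattice \<tau>" for z
    using is_pole_add_period_lattice_iff[OF _ _ pers that, of 0] by simp
  moreover have "\<not> is_pole h z" if "z \<notin> period_lattice \<tau>" for z
  proof -
    have "theta_prod \<tau> z \<noteq> 0"
      using theta_prod_eq_0_imp[OF assms] that by blast
    then have "h analytic_on {z}"
      unfolding h_def by (intro analytic_intros ana) auto
    then show ?thesis
      by (simp add: analytic_at_imp_no_pole)
  qed
  ultimately have "\<not> is_pole h z" for z
    by blast
  then obtain C c where h: "\<forall>\<^sub>\<approx>z\<in>UNIV. h z = C * exp (c * z)"
    using meromorphic_quasi_periodic_imp_exp[OF assms mer _ _ _ pers] by (metis exp_not_eq_zero neg_equal_0_iff_equal zero_neq_one)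
  have eq: "theta1 \<tau> z = C * exp (c * z) * theta_prod \<tau> z" for z
  proof -
    \<comment> \<open>Where the product vanishes, \<open>h w\<close> is a division by zero and
      carries no information; there \<open>w\<close> is a lattice point and both sides are
      0.\<close>
    have "theta1 \<tau> w = C * exp (c * w) * theta_prod \<tau> w" if "h w = C * exp (c * w)" for w
      using that theta1_period_lattice_eq_0[OF assms] theta_prod_eq_0_imp[OF assms, of w]
      by (cases "theta_prod \<tau> w = 0") (auto simp: h_def field_simps)
    then have ev: "eventually (\<lambda>w. theta1 \<tau> w = C * exp (c * w) * theta_prod \<tau> w) (at z)"
      using h eventually_mono[of "\<lambda>w. h w = C * exp (c * w)" "at z"]
      by (simp add: eventually_cosparse_open_eq)
    have "isCont (theta1 \<tau>) z" "isCont (theta_prod \<tau>) z"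
      by (intro analytic_at_imp_isCont ana)+
    then have "(theta1 \<tau> \<longlongrightarrow> theta1 \<tau> z) (at z)"
      "((\<lambda>w. C * exp (c * w) * theta_prod \<tau> w) \<longlongrightarrow> C * exp (c * z) * theta_prod \<tau> z) (at z)"
      unfolding isCont_def by (auto intro!: tendsto_intros)
    then show ?thesis
      using tendsto_cong[OF ev] LIM_unique by blast
  qed
  have "C \<noteq> 0"
  proof
    assume "C = 0"
    obtain z where z: "jtheta \<tau> z \<noteq> 0"
      using jtheta_not_identically_zero[OF assms] .
    show False
      using eq[of "z - of_real pi / 2 - of_real pi * \<tau> / 2"] z \<open>C = 0\<close>
      by (simp add: theta1_eq_jtheta assms)
  qed
  then show ?thesis
    using that eq by blast
qed

lemma theta1_eq_0_iff:
  assumes "Im \<tau> > 0"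
  shows "theta1 \<tau> z = 0 \<longleftrightarrow> z \<in> period_lattice \<tau>"
proof
  obtain C c where "C \<noteq> 0" "\<And>z. theta1 \<tau> z = C * exp (c * z) * theta_prod \<tau> z"
    using theta1_eq_theta_prod[OF assms] by blast
  then show "theta1 \<tau> z = 0 \<Longrightarrow> z \<in> period_lattice \<tau>"
    using theta_prod_eq_0_imp[OF assms] by auto
qed (rule theta1_period_lattice_eq_0[OF assms])

lemma theta1_has_field_derivative:
  "Im \<tau> > 0 \<Longrightarrow> (theta1 \<tau> has_field_derivative deriv (theta1 \<tau>) z) (at z)"
  using theta1_holomorphic[of \<tau> UNIV] holomorphic_derivI by blast

lemma deriv_theta1_0_neq_0:
  assumes "Im \<tau> > 0"
  shows "deriv (theta1 \<tau>) 0 \<noteq> 0"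
proof -
  obtain C c where C: "C \<noteq> 0" "\<And>z. theta1 \<tau> z = C * exp (c * z) * theta_prod \<tau> z"
    using theta1_eq_theta_prod[OF assms] by blast
  obtain D where D: "D \<noteq> 0" "(theta_prod \<tau> has_field_derivative D) (at 0)" "theta_prod \<tau> 0 = 0"
    using theta_prod_has_nonzero_derivative_0[OF assms] .
  have "(theta1 \<tau> has_field_derivative C * D) (at 0)"
    unfolding C(2)[abs_def] by (auto intro!: derivative_eq_intros D simp: D(3))
  then show ?thesis
    using C(1) D(1) DERIV_imp_deriv by fastforce
qed

text \<open>\<open>theta3\<close> is, up to a nonvanishing factor, \<open>theta1\<close> shifted by
  a half period. Its zeros are therefore the points pi/2 + pi * \<tau>/2 plus the lattice, the ones
  that the hypothesis of the theorem excludes for \<open>y\<close>.\<close>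

lemma theta3_eq_0_imp:
  assumes "Im \<tau> > 0" and "theta3 \<tau> y = 0"
  obtains m :: int where "exp (2 * \<i> * y) = - qpow \<tau> (of_int m + 1 / 2)"
proof -
  have "theta1 \<tau> (y - of_real pi / 2 - of_real pi * \<tau> / 2) = 0"
    using assms by (simp add: theta1_eq_jtheta theta3_eq_jtheta)
  then obtain m n :: int where "y - of_real pi / 2 - of_real pi * \<tau> / 2 = of_int m * of_real pi + of_int n * of_real pi * \<tau>"
    using theta1_eq_0_iff[OF assms(1)] by (auto simp: period_lattice_def)
  then have "2 * \<i> * y = of_real (of_int (2 * m) * pi) * \<i> + (of_real pi * \<i>
      + 2 * of_real pi * \<i> * of_real (of_int n + 1 / 2) * \<tau>)"
    by (simp add: algebra_simps)
  then have "exp (2 * \<i> * y) = exp (of_real pi * \<i>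
      + 2 * of_real pi * \<i> * of_real (of_int n + 1 / 2) * \<tau>)"
    by (metis add.commute exp_eq)
  then have "exp (2 * \<i> * y) = - qpow \<tau> (of_int n + 1 / 2)"
    by (simp add: exp_add qpow_def)
  then show ?thesis
    using that by blast
qed

section \<open>The partial fraction expansion\<close>

theorem theorem1p8:
  fixes \<tau> y :: complex and f :: "complex \<Rightarrow> complex" and a :: "nat \<Rightarrow> complex" and n :: nat
  assumes "Im \<tau> > 0"
    and "\<And>m :: int. exp (2 * \<i> * y) \<noteq> - qpow \<tau> (of_int m + 1 / 2)"
    and "f meromorphic_on UNIV"
    and "\<And>z. is_pole f z \<Longrightarrow> zorder f z = - 1"
    and "inj_on a {1..n}"
    and "complete_inequivalent_poles \<tau> f (a ` {1..n})"
    and "\<forall>\<^sub>\<approx>z\<in>UNIV. f z = - f (z + of_real pi)"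
    and "\<forall>\<^sub>\<approx>z\<in>UNIV. f z = - exp (2 * \<i> * y) * f (z + of_real pi * \<tau>)"
  shows "\<forall>\<^sub>\<approx>z\<in>UNIV. f z =
           deriv (theta1 \<tau>) 0 / theta3 \<tau> y *
           (\<Sum>k=1..n. residue f (a k) * (theta3 \<tau> (z + y - a k) / theta1 \<tau> (z - a k)))"
proof -
  note \<tau> = assms(1)
  define F where "F k z = theta3 \<tau> (z + y - a k) / theta1 \<tau> (z - a k)" for k z
  \<comment> \<open>\<open>K\<close> is the reciprocal of the residue of \<open>F k\<close> at
    \<open>a k\<close>, so each term of the sum reproduces the residue of \<open>f\<close>.\<close>
  define K where "K = deriv (theta1 \<tau>) 0 / theta3 \<tau> y"
  define h where "h z = f z - K * (\<Sum>k=1..n. residue f (a k) * F k z)" for z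
  have theta3_y: "theta3 \<tau> y \<noteq> 0"
    using theta3_eq_0_imp[OF \<tau>] assms(2) by metis
  have ana: "(\<lambda>z. theta3 \<tau> (z + y - a k)) analytic_on A" "(\<lambda>z. theta1 \<tau> (z - a k)) analytic_on A" for A k
  proof -
    have "(\<lambda>z. theta3 \<tau> (z + y - a k)) holomorphic_on UNIV" "(\<lambda>z. theta1 \<tau> (z - a k)) holomorphic_on UNIV"
      by (intro holomorphic_intros holomorphic_on_compose_gen[OF _ theta3_holomorphic[OF \<tau>, of UNIV], unfolded o_def]
          holomorphic_on_compose_gen[OF _ theta1_holomorphic[OF \<tau>, of UNIV], unfolded o_def]; simp)+
    then show "(\<lambda>z. theta3 \<tau> (z + y - a k)) analytic_on A" "(\<lambda>z. theta1 \<tau> (z - a k)) analytic_on A"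
      using analytic_on_subset[of _ UNIV A] by (auto simp: analytic_on_open)
  qed
  have F_mer: "F k meromorphic_on A" for k A
    unfolding F_def by (intro meromorphic_intros analytic_on_imp_meromorphic_on ana)
  have F_ana: "F k analytic_on {z}" if "z - a k \<notin> period_lattice \<tau>" for k z
    unfolding F_def using that by (intro analytic_intros ana) (simp add: theta1_eq_0_iff[OF \<tau>])
  have h_mer: "h meromorphic_on UNIV"
    unfolding h_def by (intro meromorphic_intros F_mer assms(3))
  have iso: "isolated_singularity_at f z" "isolated_singularity_at h z" for z
    using meromorphic_on_subset[OF assms(3), of "{z}"] meromorphic_on_subset[OF h_mer, of "{z}"]
    by (simp_all add: meromorphic_at_iff)
  have F1: "F k (z + of_real pi) = - 1 * F k z" for k z
    using theta3_add_pi[OF \<tau>, of "z + y - a k"] theta1_add_pi[OF \<tau>, of "z - a k"]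
    by (simp add: F_def algebra_simps)
  have F2: "F k (z + of_real pi * \<tau>) = - exp (- (2 * \<i> * y)) * F k z" for k z
  proof -
    \<comment> \<open>\<open>u\<close> is the factor common to \<open>theta1\<close> and
      \<open>theta3\<close> under this shift. It cancels in the quotient, and only the contribution
      of \<open>y\<close> survives.\<close>
    define u where "u = exp (- \<i> * (of_real pi * \<tau> + 2 * (z - a k)))"
    have "exp (- \<i> * (of_real pi * \<tau> + 2 * (z + y - a k))) = u * exp (- (2 * \<i> * y))"
      unfolding u_def exp_add[symmetric] by (rule arg_cong[of _ _ exp]) (simp add: algebra_simps)
    then have "theta3 \<tau> (z + y - a k + of_real pi * \<tau>) = u * exp (- (2 * \<i> * y)) * theta3 \<tau> (z + y - a k)"
      by (simp only: theta3_add_pi_tau[OF \<tau>])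
    moreover have "theta1 \<tau> (z - a k + of_real pi * \<tau>) = - u * theta1 \<tau> (z - a k)"
      by (simp only: theta1_add_pi_tau[OF \<tau>] u_def)
    moreover have "u \<noteq> 0"
      by (simp add: u_def)
    moreover have "z + of_real pi * \<tau> + y - a k = z + y - a k + of_real pi * \<tau>"
      "z + of_real pi * \<tau> - a k = z - a k + of_real pi * \<tau>"
      by simp_all
    ultimately show ?thesis
      unfolding F_def by (simp add: field_simps)
  qed
  have per1: "\<forall>\<^sub>\<approx>z\<in>UNIV. h (z + of_real pi) = - 1 * h z"
    using assms(7) by eventually_elim (simp add: h_def F1 sum_negf)
  have S2: "(\<Sum>k=1..n. residue f (a k) * F k (z + of_real pi * \<tau>))
      = - exp (- (2 * \<i> * y)) * (\<Sum>k=1..n. residue f (a k) * F k z)" for z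
    unfolding F2 sum_distrib_left by (rule sum.cong) simp_all
  have per2: "\<forall>\<^sub>\<approx>z\<in>UNIV. h (z + of_real pi * \<tau>) = - exp (- (2 * \<i> * y)) * h z"
    using assms(8)
  proof eventually_elim
    case (elim z)
    then have "f (z + of_real pi * \<tau>) = - exp (- (2 * \<i> * y)) * f z"
      by (simp add: exp_minus)
    then show ?case
      unfolding h_def S2 by (simp only: right_diff_distrib mult.left_commute)
  qed
  \<comment> \<open>By invariance under the lattice only the representatives \<open>a j\<close>
    matter. There \<open>F j\<close> has residue \<open>inverse K\<close>, and the other
    \<open>F k\<close> are analytic because \<open>a j\<close> and \<open>a k\<close> are
    inequivalent.\<close>
  have no_pole_at_a: "\<not> is_pole h (a j)" if j: "j \<in> {1..n}" for j
  proof (rule not_is_pole_if_mult_tendsto_0[OF iso(2)])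
    have pole: "is_pole f (a j)"
      using assms(6) j by (auto simp: complete_inequivalent_poles_def)
    have "((\<lambda>z. (z - a j) * F k z) \<longlongrightarrow> (if k = j then inverse K else 0)) (at (a j))" if k: "k \<in> {1..n}" for k
    proof (cases "k = j")
      case True
      have "((\<lambda>z. theta1 \<tau> z / z) \<longlongrightarrow> deriv (theta1 \<tau>) 0) (at 0)"
        using theta1_has_field_derivative[OF \<tau>, of 0] by (simp add: has_field_derivative_iff theta1_0)
      then have "((\<lambda>z. theta1 \<tau> (z - a j) / (z - a j)) \<longlongrightarrow> deriv (theta1 \<tau>) 0) (at (a j))"
        by (simp add: at_to_0[of "a j"] filterlim_filtermap)
      moreover have "((\<lambda>z. theta3 \<tau> (z + y - a j)) \<longlongrightarrow> theta3 \<tau> y) (at (a j))"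
        using analytic_at_imp_isCont[OF ana(1)[where k = j and A = "{a j}"]] by (simp add: isCont_def)
      ultimately have "((\<lambda>z. theta3 \<tau> (z + y - a j) / (theta1 \<tau> (z - a j) / (z - a j)))
          \<longlongrightarrow> theta3 \<tau> y / deriv (theta1 \<tau>) 0) (at (a j))"
        using deriv_theta1_0_neq_0[OF \<tau>] by (intro tendsto_divide)
      then show ?thesis
        using True by (simp add: F_def K_def mult.commute)
    next
      case False
      then have "a j \<noteq> a k"
        using inj_onD[OF assms(5) _ j k] by blast
      then have "a j - a k \<notin> period_lattice \<tau>"
        using assms(6) j k unfolding complete_inequivalent_poles_def lattice_equiv_def by blast
      from analytic_at_imp_isCont[OF F_ana[OF this]]
      have "((\<lambda>z. (z - a j) * F k z) \<longlongrightarrow> (a j - a j) * F k (a j)) (at (a j))"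
        unfolding isCont_def by (intro tendsto_intros)
      then show ?thesis
        using False by simp
    qed
    then have "((\<lambda>z. (z - a j) * f z - K * (\<Sum>k=1..n. residue f (a k) * ((z - a j) * F k z)))
        \<longlongrightarrow> residue f (a j) - K * (\<Sum>k=1..n. residue f (a k) * (if k = j then inverse K else 0))) (at (a j))"
      by (intro tendsto_diff[OF simple_pole_tendsto_residue[OF iso(1) pole assms(4)[OF pole]]]
          tendsto_mult_left tendsto_sum)
    also have "(\<Sum>k=1..n. residue f (a k) * (if k = j then inverse K else 0)) = residue f (a j) * inverse K"
      using j by (simp add: if_distrib sum.delta cong: if_cong)
    also have "residue f (a j) - K * (residue f (a j) * inverse K) = 0"
      using theta3_y deriv_theta1_0_neq_0[OF \<tau>] by (simp add: K_def)
    also have "(\<lambda>z. (z - a j) * f z - K * (\<Sum>k=1..n. residue f (a k) * ((z - a j) * F k z)))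
        = (\<lambda>z. (z - a j) * h z)"
      by (simp add: h_def fun_eq_iff right_diff_distrib sum_distrib_left mult_ac)
    finally show "((\<lambda>z. (z - a j) * h z) \<longlongrightarrow> 0) (at (a j))" .
  qed
  have "\<not> is_pole h z" for z
  proof (cases "\<exists>j\<in>{1..n}. z - a j \<in> period_lattice \<tau>")
    case True
    then obtain j where "j \<in> {1..n}" "z - a j \<in> period_lattice \<tau>"
      by blast
    then show ?thesis
      using no_pole_at_a is_pole_add_period_lattice_iff[OF _ _ per1 per2, of "z - a j" "a j"] by simp
  next
    case False
    then have "\<not> is_pole f z"
      using assms(6) by (auto simp: complete_inequivalent_poles_def lattice_equiv_def)
    \<comment> \<open>Away from all translates of the \<open>a j\<close>, \<open>f\<close> has a
      finite limit and the sum is analytic, so \<open>h\<close> has a finite limit too.\<close>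
    then obtain l where "(f \<longlongrightarrow> l) (at z)"
      using meromorphic_on_subset[OF assms(3), of "{z}"] by (auto simp: meromorphic_at_iff not_essential_def)
    moreover have "(\<lambda>z. K * (\<Sum>k=1..n. residue f (a k) * F k z)) analytic_on {z}"
      using False by (intro analytic_intros F_ana) auto
    then have "((\<lambda>w. K * (\<Sum>k=1..n. residue f (a k) * F k w))
        \<longlongrightarrow> K * (\<Sum>k=1..n. residue f (a k) * F k z)) (at z)"
      using analytic_at_imp_isCont isCont_def by blast
    ultimately have "(h \<longlongrightarrow> l - K * (\<Sum>k=1..n. residue f (a k) * F k z)) (at z)"
      unfolding h_def by (intro tendsto_diff)
    then show ?thesis
      unfolding is_pole_def using not_tendsto_and_filterlim_at_infinity at_neq_bot by blast
  qed
  then obtain C c where C: "\<forall>\<^sub>\<approx>z\<in>UNIV. h z = C * exp (c * z)"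
    and mult: "C = 0 \<or> exp (c * of_real pi) = - 1 \<and> exp (c * (of_real pi * \<tau>)) = - exp (- (2 * \<i> * y))"
    using meromorphic_quasi_periodic_imp_exp[OF \<tau> h_mer _ _ _ per1 per2] by auto
  have "C = 0"
  proof (rule ccontr)
    assume "C \<noteq> 0"
    with mult have c: "exp (c * of_real pi) = exp (of_real pi * \<i>)"
      "exp (c * (of_real pi * \<tau>)) = - exp (- (2 * \<i> * y))"
      by simp_all
    \<comment> \<open>The multiplier -1 forces \<open>c\<close> to be an odd multiple of i. The
      other multiplier then puts e^(2 i y) among the excluded values, with index -m - 1 since -(m +
      1/2) = (-m - 1) + 1/2.\<close>
    from c(1) obtain m :: int where "c * of_real pi = of_real pi * \<i> + of_real (of_int (2 * m) * pi) * \<i>"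
      unfolding exp_eq by auto
    then have "of_real pi * (c - (2 * of_int m + 1) * \<i>) = 0"
      by (simp add: algebra_simps)
    then have "c = (2 * of_int m + 1) * \<i>"
      by simp
    then have "c * (of_real pi * \<tau>) = - (2 * of_real pi * \<i> * of_real (of_int (- m - 1) + 1 / 2) * \<tau>)"
      by (simp add: field_simps)
    with c(2) have "inverse (qpow \<tau> (of_int (- m - 1) + 1 / 2)) = - inverse (exp (2 * \<i> * y))"
      by (simp only: qpow_def exp_minus)
    then have "exp (2 * \<i> * y) = - qpow \<tau> (of_int (- m - 1) + 1 / 2)"
      by (metis inverse_inverse_eq inverse_minus_eq minus_minus)
    with assms(2) show False
      by blast
  qed
  then show ?thesis
    using C unfolding h_def F_def K_def by simp
qed

end
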